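(* Let $n\ge 1$ and let $k\ge 0$ be an integer. The power $k$ barcode poset $(L((2^k+1)^n)/\mathfrak{S}_n,\leq_k)$ is order-isomorphic to a principal ideal of the multinomial Newman lattice $L((2^k+1)^n)$. Consequently, $(L((2^k+1)^n)/\mathfrak{S}_n,\leq_k)$ is a lattice.
   Context: Multinomial Newman lattice. For $\mathbf{m}=(m_1,\ldots,m_n)$ with positive integer entries, $L(\mathbf m)$ is the set of all permutations (written as words) of the multiset $\{1^{m_1},\ldots,n^{m_n}\}$ (exponents are multiplicities). Let $S=\{1_1,\ldots,1_{m_1},\ldots,n_1,\ldots,n_{m_n}\}$, totally ordered lexicographically ($1_1<1_2<\cdots<1_{m_1}<2_1<\cdots<n_{m_n}$), and let $\mathfrak{S}_S$ be the set of permutations of $S$ in one-line notation. The map $\iota:L(\mathbf m)\to\mathfrak{S}_S$ replaces, for each $i$, the successive occurrences of $i$ in the word, from left to right, by $i_1,i_2,\ldots,i_{m_i}$. For $\pi\in\mathfrak{S}_S$, $\mathrm{inv}(\pi)$ is the set of pairs $(\pi_a,\pi_b)$ with $a<b$ and $\pi_a>\pi_b$. The multinomial Newman order on $L(\mathbf m)$ is: $s\le t$ if and only if $\mathrm{inv}(\iota(s))\subseteq\mathrm{inv}(\iota(t))$. This makes $L(\mathbf m)$ a lattice. A principal ideal is a subposet $\{s\in L: s\le\alpha\}$ for some $\alpha\in L$. $L((2^k+1)^n)$ denotes $L(\mathbf m)$ with $\mathbf m=(2^k+1,\ldots,2^k+1)$ ($n$ entries). Power $k$ barcode poset. The symmetric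 group $\mathfrak{S}_n$ acts on $L((2^k+1)^n)$ by relabeling entries: $\pi\circ s$ is obtained by applying $\pi$ to every entry of the word $s$. $[s]$ denotes the orbit of $s$. For $s\in L((2^k+1)^n)$, let $\tau_s\in\mathfrak{S}_n$ be the permutation whose one-line notation is the subword of $s$ formed by the first occurrence of each element. The canonical representative of $[s]$ is $\psi_k([s])=\tau_s^{-1}\circ s$, which does not depend on the choice of $s$ in its orbit. The relation $\leq_k$ on $L((2^k+1)^n)/\mathfrak{S}_n$ is: $[s]\leq_k[t]$ if and only if $\psi_k([s])\le\psi_k([t])$ in the multinomial Newman order. *)

theory Defs
  imports
    "HOL-Algebra.Lattice"
    "HOL-Algebra.Group_Action"
    "HOL-Algebra.Sym_Groups"
    "HOL-Combinatorics.Multiset_Permutations"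
begin

section \<open>The multinomial Newman lattice\<close>

text \<open>
  A vector of multiplicities \<open>(m\<^sub>1, \<dots>, m\<^sub>n)\<close> is a list \<open>ms\<close> of length \<open>n\<close>; lists are indexed
  from 0, so \<open>m\<^sub>i\<close> is \<open>ms ! (i - 1)\<close>.
\<close>

definition newman_words :: "nat list \<Rightarrow> nat list set" where
  "newman_words ms =
     permutations_of_multiset (\<Sum>i\<in>{1..length ms}. replicate_mset (ms ! (i - 1)) i)"

text \<open>
  The map \<open>\<iota>\<close>. The element \<open>i\<^sub>j\<close> of \<open>S\<close> is the pair \<open>(i, j)\<close>: an occurrence of \<open>i\<close> is replaced
  by \<open>i\<^sub>j\<close>, where \<open>j\<close> counts the occurrences of \<open>i\<close> up to and including that position.
\<close>

definition standardize :: "nat list \<Rightarrow> (nat \<times> nat) list" where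
  "standardize s = map (\<lambda>a. (s ! a, count_list (take (Suc a) s) (s ! a))) [0..<length s]"

definition inversions :: "(nat \<times> nat) list \<Rightarrow> ((nat \<times> nat) \<times> (nat \<times> nat)) set" where
  "inversions p =
     {(p ! a, p ! b) | a b. a < b \<and> b < length p \<and> (p ! b, p ! a) \<in> less_than <*lex*> less_than}"

definition newman_le :: "nat list \<Rightarrow> nat list \<Rightarrow> bool" where
  "newman_le s t \<longleftrightarrow> inversions (standardize s) \<subseteq> inversions (standardize t)"

definition newman_poset :: "nat list \<Rightarrow> nat list gorder" where
  "newman_poset ms = \<lparr>carrier = newman_words ms, eq = (=), le = newman_le\<rparr>"

section \<open>Principal ideals and order isomorphisms\<close>

definition principal_down_set :: "'a gorder \<Rightarrow> 'a \<Rightarrow> 'a gorder" where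
  "principal_down_set P \<alpha> = P\<lparr>carrier := {s \<in> carrier P. s \<sqsubseteq>\<^bsub>P\<^esub> \<alpha>}\<rparr>"

definition order_isomorphic :: "'a gorder \<Rightarrow> 'b gorder \<Rightarrow> bool" where
  "order_isomorphic P Q \<longleftrightarrow>
     (\<exists>f. bij_betw f (carrier P) (carrier Q) \<and>
          (\<forall>x\<in>carrier P. \<forall>y\<in>carrier P. x \<sqsubseteq>\<^bsub>P\<^esub> y \<longleftrightarrow> f x \<sqsubseteq>\<^bsub>Q\<^esub> f y))"

section \<open>The power \<open>k\<close> barcode poset\<close>

definition barcode_mults :: "nat \<Rightarrow> nat \<Rightarrow> nat list" where
  "barcode_mults n k = replicate n (2 ^ k + 1)"

text \<open>The function \<^const>\<open>remdups\<close> keeps last occurrences, hence the two reversals.\<close>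

definition first_occurrences :: "nat list \<Rightarrow> nat list" where
  "first_occurrences s = rev (remdups (rev s))"

text \<open>
  The permutation \<open>\<tau>\<^sub>s\<close> of \<open>{1..n}\<close>, extended by the identity, as are all elements of
  \<^term>\<open>carrier (sym_group n)\<close>.
\<close>

definition first_occ_perm :: "nat \<Rightarrow> nat list \<Rightarrow> nat \<Rightarrow> nat" where
  "first_occ_perm n s = (\<lambda>i. if i \<in> {1..n} then first_occurrences s ! (i - 1) else i)"

text \<open>
  The action of a permutation \<open>\<pi>\<close> on words is \<^term>\<open>map \<pi>\<close>. The map \<open>\<psi>\<^sub>k\<close> takes an orbit to the
  common value of \<open>\<tau>\<^sub>s\<^sup>-\<^sup>1 \<circ> s\<close> over its elements \<open>s\<close>. It is written without the parameter \<open>k\<close>,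
  since the defining formula does not involve it.
\<close>

definition canonical_rep :: "nat \<Rightarrow> nat list set \<Rightarrow> nat list" where
  "canonical_rep n X =
     the_elem ((\<lambda>s. map (Hilbert_Choice.inv (first_occ_perm n s)) s) ` X)"

text \<open>The value does not depend on the element of the orbit.\<close>

lemma remdups_map_inj: "inj f \<Longrightarrow> remdups (map f xs) = map f (remdups xs)"
  by (induction xs) (auto simp: inj_image_mem_iff)

lemma set_newman_words:
  assumes "s \<in> newman_words ms" and "\<forall>i\<in>{1..length ms}. ms ! (i - 1) > 0"
  shows "set s = {1..length ms}"
proof -
  have "set_mset (mset s) = {1..length ms}"
    using assms unfolding newman_words_def permutations_of_multiset_def
    by (auto simp: set_mset_sum)
  then show ?thesis by simp
qed

lemma length_first_occurrences:
  "length (first_occurrences s) = card (set s)"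
  by (simp add: first_occurrences_def length_remdups_card_conv)

lemma first_occ_perm_permutes:
  assumes "set s = {1..n}"
  shows "first_occ_perm n s permutes {1..n}"
proof -
  let ?w = "first_occurrences s"
  have w: "distinct ?w" "set ?w = {1..n}" "length ?w = n"
    using assms by (auto simp: first_occurrences_def length_remdups_card_conv)
  have "bij_betw (\<lambda>i. i - 1) {1..n} {..<n}"
    by (rule bij_betw_byWitness[where f' = Suc]) auto
  moreover have "bij_betw ((!) ?w) {..<n} {1..n}"
    using bij_betw_nth[OF w(1)] w by auto
  ultimately have "bij_betw ((!) ?w \<circ> (\<lambda>i. i - 1)) {1..n} {1..n}"
    by (rule bij_betw_trans)
  then have "bij_betw (first_occ_perm n s) {1..n} {1..n}"
    by (rule bij_betw_cong[THEN iffD1, rotated]) (auto simp: first_occ_perm_def)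
  then show ?thesis
    by (rule bij_imp_permutes) (auto simp: first_occ_perm_def)
qed

lemma canonical_rep_orbit:
  assumes s: "s \<in> newman_words ms" and pos: "\<forall>i\<in>{1..length ms}. ms ! (i - 1) > 0"
  shows "canonical_rep (length ms) (orbit (sym_group (length ms)) map s) =
         map (Hilbert_Choice.inv (first_occ_perm (length ms) s)) s"
proof -
  let ?n = "length ms"
  let ?c = "\<lambda>s. map (Hilbert_Choice.inv (first_occ_perm ?n s)) s"
  note set_s = set_newman_words[OF s pos]
  have tau: "bij (first_occ_perm ?n s)"
    using first_occ_perm_permutes[OF set_s] by (rule permutes_bij)
  have *: "?c (map p s) = ?c s" if p: "p permutes {1..?n}" for p
  proof -
    have "first_occurrences (map p s) = map p (first_occurrences s)"
      by (simp add: first_occurrences_def rev_map remdups_map_inj[OF permutes_inj[OF p]])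
    then have "first_occ_perm ?n (map p s) = p \<circ> first_occ_perm ?n s"
      using permutes_not_in[OF p] length_first_occurrences[of s] set_s
      by (auto simp: first_occ_perm_def fun_eq_iff)
    then have "Hilbert_Choice.inv (first_occ_perm ?n (map p s)) \<circ> p =
               Hilbert_Choice.inv (first_occ_perm ?n s)"
      using o_inv_distrib[OF permutes_bij[OF p] tau] permutes_inv_o(2)[OF p]
      by (simp add: comp_assoc)
    then show ?thesis by simp
  qed
  have orb: "orbit (sym_group ?n) map s = (\<lambda>p. map p s) ` {p. p permutes {1..?n}}"
    by (auto simp: orbit_def sym_group_def)
  have "?c ` orbit (sym_group ?n) map s = (\<lambda>p. ?c (map p s)) ` {p. p permutes {1..?n}}"
    unfolding orb by (rule image_image)
  also have "\<dots> = (\<lambda>p. ?c s) ` {p. p permutes {1..?n}}"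
    by (rule image_cong[OF refl]) (rule *, simp)
  also have "\<dots> = {?c s}"
    by (rule image_constant[of id]) (simp add: permutes_id)
  finally have "?c ` orbit (sym_group ?n) map s = {?c s}" .
  then show ?thesis by (simp add: canonical_rep_def)
qed

definition barcode_poset :: "nat \<Rightarrow> nat \<Rightarrow> nat list set gorder" where
  "barcode_poset n k =
     \<lparr>carrier = orbits (sym_group n) (newman_words (barcode_mults n k)) map,
      eq = (=),
      le = (\<lambda>X Y. newman_le (canonical_rep n X) (canonical_rep n Y))\<rparr>"

end

theory Submission
  imports Defs
begin

text \<open>
  The canonical representatives are the words in which the letters first occur in increasing
  order, that is, with no letter larger than \<open>i\<close> before \<open>i\<^sub>1\<close>. These are
  exactly the words below \<open>\<alpha> = 1 2 \<dots> n n\<dots>n \<dots> 1\<dots>1\<close>; hence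
  \<open>\<psi>\<^sub>k\<close> is an isomorphism onto the principal ideal of \<open>\<alpha>\<close>. The Newman order is a lattice
  because inversion sets of words are the biclosed sets of pairs (transitive with transitive
  complement) that contain no pair of equal letters: the transitive closure of the union of two
  biclosed sets is biclosed, which gives joins, and passing to complements gives meets.
\<close>

section \<open>Lattices and order isomorphisms\<close>

text \<open>The order locales work over a setoid; with plain equality as \<open>eq\<close>, the
  order axioms and the bounds of pairs are all that remains. Bounds are asked for elementwise, a
  form that passes easily to subsets and along bijections.\<close>

lemma latticeI:
  fixes P :: "'a gorder"
  assumes "eq P = (=)" and "\<And>x. x \<in> carrier P \<Longrightarrow> x \<sqsubseteq>\<^bsub>P\<^esub> x"
    and "\<And>x y. x \<in> carrier P \<Longrightarrow> y \<in> carrier P \<Longrightarrow> x \<sqsubseteq>\<^bsub>P\<^esub> y \<Longrightarrow> y \<sqsubseteq>\<^bsub>P\<^esub> x \<Longrightarrow> x = y"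
    and "\<And>x y z. x \<in> carrier P \<Longrightarrow> y \<in> carrier P \<Longrightarrow> z \<in> carrier P \<Longrightarrow>
      x \<sqsubseteq>\<^bsub>P\<^esub> y \<Longrightarrow> y \<sqsubseteq>\<^bsub>P\<^esub> z \<Longrightarrow> x \<sqsubseteq>\<^bsub>P\<^esub> z"
    and join: "\<And>x y. x \<in> carrier P \<Longrightarrow> y \<in> carrier P \<Longrightarrow>
      \<exists>j\<in>carrier P. x \<sqsubseteq>\<^bsub>P\<^esub> j \<and> y \<sqsubseteq>\<^bsub>P\<^esub> j \<and>
        (\<forall>z\<in>carrier P. x \<sqsubseteq>\<^bsub>P\<^esub> z \<longrightarrow> y \<sqsubseteq>\<^bsub>P\<^esub> z \<longrightarrow> j \<sqsubseteq>\<^bsub>P\<^esub> z)"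
    and meet: "\<And>x y. x \<in> carrier P \<Longrightarrow> y \<in> carrier P \<Longrightarrow>
      \<exists>m\<in>carrier P. m \<sqsubseteq>\<^bsub>P\<^esub> x \<and> m \<sqsubseteq>\<^bsub>P\<^esub> y \<and>
        (\<forall>z\<in>carrier P. z \<sqsubseteq>\<^bsub>P\<^esub> x \<longrightarrow> z \<sqsubseteq>\<^bsub>P\<^esub> y \<longrightarrow> z \<sqsubseteq>\<^bsub>P\<^esub> m)"
  shows "lattice P"
proof unfold_locales
  fix x y assume xy: "x \<in> carrier P" "y \<in> carrier P"
  from join[OF xy] obtain j where "j \<in> carrier P" "x \<sqsubseteq>\<^bsub>P\<^esub> j" "y \<sqsubseteq>\<^bsub>P\<^esub> j"
    "\<forall>z\<in>carrier P. x \<sqsubseteq>\<^bsub>P\<^esub> z \<longrightarrow> y \<sqsubseteq>\<^bsub>P\<^esub> z \<longrightarrow> j \<sqsubseteq>\<^bsub>P\<^esub> z" by blast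
  with xy show "\<exists>s. least P s (Upper P {x, y})"
    by (intro exI[of _ j]) (auto simp: least_def Upper_def)
  from meet[OF xy] obtain m where "m \<in> carrier P" "m \<sqsubseteq>\<^bsub>P\<^esub> x" "m \<sqsubseteq>\<^bsub>P\<^esub> y"
    "\<forall>z\<in>carrier P. z \<sqsubseteq>\<^bsub>P\<^esub> x \<longrightarrow> z \<sqsubseteq>\<^bsub>P\<^esub> y \<longrightarrow> z \<sqsubseteq>\<^bsub>P\<^esub> m" by blast
  with xy show "\<exists>s. greatest P s (Lower P {x, y})"
    by (intro exI[of _ m]) (auto simp: greatest_def Lower_def)
qed (simp_all add: assms(1,2), (use assms(3,4) in blast)+)

lemma (in lattice) obtain_join:
  assumes "x \<in> carrier L" "y \<in> carrier L"
  obtains j where "j \<in> carrier L" "x \<sqsubseteq> j" "y \<sqsubseteq> j"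
    "\<And>z. z \<in> carrier L \<Longrightarrow> x \<sqsubseteq> z \<Longrightarrow> y \<sqsubseteq> z \<Longrightarrow> j \<sqsubseteq> z"
  using assms by (intro that[of "x \<squnion> y"]) (auto intro: join_left join_right join_le)

lemma (in lattice) obtain_meet:
  assumes "x \<in> carrier L" "y \<in> carrier L"
  obtains m where "m \<in> carrier L" "m \<sqsubseteq> x" "m \<sqsubseteq> y"
    "\<And>z. z \<in> carrier L \<Longrightarrow> z \<sqsubseteq> x \<Longrightarrow> z \<sqsubseteq> y \<Longrightarrow> z \<sqsubseteq> m"
  using assms by (intro that[of "x \<sqinter> y"]) (auto intro: meet_left meet_right meet_le)

text \<open>Bounds are inherited from \<open>P\<close>: \<open>a\<close> is itself an upper bound of
  \<open>x\<close> and \<open>y\<close>, so their join stays below it, and their meet does so by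
  transitivity.\<close>

lemma lattice_principal_down_set:
  fixes P :: "'a gorder"
  assumes "lattice P" and a: "a \<in> carrier P"
  shows "lattice (principal_down_set P a)"
proof -
  interpret lattice P by fact
  let ?Q = "principal_down_set P a"
  have [simp]: "carrier ?Q = {s \<in> carrier P. s \<sqsubseteq>\<^bsub>P\<^esub> a}" "le ?Q = le P" "eq ?Q = (=)"
    by (simp_all add: principal_down_set_def eq_is_equal)
  show ?thesis
  proof (rule latticeI)
    fix x y assume "x \<in> carrier ?Q" "y \<in> carrier ?Q"
    then have xy: "x \<in> carrier P" "y \<in> carrier P" "x \<sqsubseteq>\<^bsub>P\<^esub> a" "y \<sqsubseteq>\<^bsub>P\<^esub> a" by auto
    from obtain_join[OF xy(1,2)] xy a show "\<exists>j\<in>carrier ?Q. x \<sqsubseteq>\<^bsub>?Q\<^esub> j \<and> y \<sqsubseteq>\<^bsub>?Q\<^esub> j \<and>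
        (\<forall>z\<in>carrier ?Q. x \<sqsubseteq>\<^bsub>?Q\<^esub> z \<longrightarrow> y \<sqsubseteq>\<^bsub>?Q\<^esub> z \<longrightarrow> j \<sqsubseteq>\<^bsub>?Q\<^esub> z)"
      by simp metis
    obtain m where "m \<in> carrier P" "m \<sqsubseteq>\<^bsub>P\<^esub> x" "m \<sqsubseteq>\<^bsub>P\<^esub> y"
      "\<And>z. z \<in> carrier P \<Longrightarrow> z \<sqsubseteq>\<^bsub>P\<^esub> x \<Longrightarrow> z \<sqsubseteq>\<^bsub>P\<^esub> y \<Longrightarrow> z \<sqsubseteq>\<^bsub>P\<^esub> m"
      using obtain_meet[OF xy(1,2)] by metis
    moreover from this xy a have "m \<sqsubseteq>\<^bsub>P\<^esub> a" by (meson le_trans)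
    ultimately show "\<exists>m\<in>carrier ?Q. m \<sqsubseteq>\<^bsub>?Q\<^esub> x \<and> m \<sqsubseteq>\<^bsub>?Q\<^esub> y \<and>
        (\<forall>z\<in>carrier ?Q. z \<sqsubseteq>\<^bsub>?Q\<^esub> x \<longrightarrow> z \<sqsubseteq>\<^bsub>?Q\<^esub> y \<longrightarrow> z \<sqsubseteq>\<^bsub>?Q\<^esub> m)"
      by (intro bexI[of _ m]) auto
  qed (auto intro: le_trans le_antisym)
qed

text \<open>Bounds are formed in \<open>Q\<close> from the images and pulled back along
  \<open>f\<close>.\<close>

lemma lattice_order_isomorphic:
  fixes P :: "'a gorder" and Q :: "'b gorder"
  assumes "order_isomorphic P Q" and "lattice Q" and eq: "eq P = (=)"
  shows "lattice P"
proof -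
  interpret Q: lattice Q by fact
  from assms(1) obtain f where f: "bij_betw f (carrier P) (carrier Q)"
    and le: "\<And>x y. x \<in> carrier P \<Longrightarrow> y \<in> carrier P \<Longrightarrow> x \<sqsubseteq>\<^bsub>P\<^esub> y \<longleftrightarrow> f x \<sqsubseteq>\<^bsub>Q\<^esub> f y"
    unfolding order_isomorphic_def by blast
  have img: "f x \<in> carrier Q" if "x \<in> carrier P" for x
    using f that by (auto simp: bij_betw_def)
  have surj: "\<exists>x\<in>carrier P. f x = y" if "y \<in> carrier Q" for y
    using f that by (metis bij_betw_imp_surj_on imageE)
  have inj: "x = y" if "x \<in> carrier P" "y \<in> carrier P" "f x = f y" for x y
    using f that by (auto simp: bij_betw_def inj_on_def)
  show ?thesis
  proof (rule latticeI)
    fix x y assume xy: "x \<in> carrier P" "y \<in> carrier P"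
    obtain j where j: "j \<in> carrier Q" "f x \<sqsubseteq>\<^bsub>Q\<^esub> j" "f y \<sqsubseteq>\<^bsub>Q\<^esub> j"
      "\<And>z. z \<in> carrier Q \<Longrightarrow> f x \<sqsubseteq>\<^bsub>Q\<^esub> z \<Longrightarrow> f y \<sqsubseteq>\<^bsub>Q\<^esub> z \<Longrightarrow> j \<sqsubseteq>\<^bsub>Q\<^esub> z"
      using Q.obtain_join[OF img img, OF xy] by metis
    from surj[OF j(1)] obtain i where "i \<in> carrier P" "f i = j" by blast
    with j xy show "\<exists>j\<in>carrier P. x \<sqsubseteq>\<^bsub>P\<^esub> j \<and> y \<sqsubseteq>\<^bsub>P\<^esub> j \<and>
        (\<forall>z\<in>carrier P. x \<sqsubseteq>\<^bsub>P\<^esub> z \<longrightarrow> y \<sqsubseteq>\<^bsub>P\<^esub> z \<longrightarrow> j \<sqsubseteq>\<^bsub>P\<^esub> z)"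
      by (intro bexI[of _ i]) (auto simp: le img)
    obtain m where m: "m \<in> carrier Q" "m \<sqsubseteq>\<^bsub>Q\<^esub> f x" "m \<sqsubseteq>\<^bsub>Q\<^esub> f y"
      "\<And>z. z \<in> carrier Q \<Longrightarrow> z \<sqsubseteq>\<^bsub>Q\<^esub> f x \<Longrightarrow> z \<sqsubseteq>\<^bsub>Q\<^esub> f y \<Longrightarrow> z \<sqsubseteq>\<^bsub>Q\<^esub> m"
      using Q.obtain_meet[OF img img, OF xy] by metis
    from surj[OF m(1)] obtain i where "i \<in> carrier P" "f i = m" by blast
    with m xy show "\<exists>m\<in>carrier P. m \<sqsubseteq>\<^bsub>P\<^esub> x \<and> m \<sqsubseteq>\<^bsub>P\<^esub> y \<and>
        (\<forall>z\<in>carrier P. z \<sqsubseteq>\<^bsub>P\<^esub> x \<longrightarrow> z \<sqsubseteq>\<^bsub>P\<^esub> y \<longrightarrow> z \<sqsubseteq>\<^bsub>P\<^esub> m)"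
      by (intro bexI[of _ i]) (auto simp: le img)
  next
    fix x y z assume "x \<in> carrier P" "y \<in> carrier P" "z \<in> carrier P" "x \<sqsubseteq>\<^bsub>P\<^esub> y" "y \<sqsubseteq>\<^bsub>P\<^esub> z"
    then show "x \<sqsubseteq>\<^bsub>P\<^esub> z" using Q.le_trans[of "f x" "f y" "f z"] by (simp add: le img)
  next
    fix x y assume "x \<in> carrier P" "y \<in> carrier P" "x \<sqsubseteq>\<^bsub>P\<^esub> y" "y \<sqsubseteq>\<^bsub>P\<^esub> x"
    then show "x = y" using Q.le_antisym[of "f x" "f y"] by (auto simp: le img intro: inj)
  qed (simp_all add: eq le img)
qed

section \<open>Biclosed sets\<close>

definition biclosed :: "('a \<times> 'a) set \<Rightarrow> ('a \<times> 'a) set \<Rightarrow> bool" where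
  "biclosed G K \<longleftrightarrow> K \<subseteq> G \<and> trans K \<and> trans (G - K)"

lemma biclosed_Diff: "biclosed G K \<Longrightarrow> biclosed G (G - K)"
  by (auto simp: biclosed_def Diff_Diff_Int Int_absorb1)

text \<open>Transitivity of the complement is proved in contrapositive form: if
  \<open>(z, x)\<close> lies in the closure and \<open>y\<close> sits between \<open>z\<close> and
  \<open>x\<close> in \<open>G\<close>, then one of the halves \<open>(z, y)\<close>,
  \<open>(y, x)\<close> lies in the closure. The closure is then the least transitive set above
  both, hence the candidate for a join.\<close>

lemma biclosed_trancl_Un:
  assumes "trans G" and tot: "total_on (Field G) G" and I: "biclosed G I" and J: "biclosed G J"
  shows "biclosed G ((I \<union> J)\<^sup>+)"
proof -
  let ?U = "I \<union> J" and ?T = "(I \<union> J)\<^sup>+"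
  have sub: "?T \<subseteq> G"
    using I J trancl_mono_subset[of ?U G] trancl_id[OF \<open>trans G\<close>] by (auto simp: biclosed_def)
  \<comment> \<open>Whichever of \<open>I\<close> and \<open>J\<close> contains
    \<open>(z, x)\<close> also contains one of the halves, its complement being transitive.\<close>
  have split: "(z, y) \<in> ?U \<or> (y, x) \<in> ?U" if "(z, x) \<in> ?U" "(z, y) \<in> G" "(y, x) \<in> G" for x y z
    using that I J unfolding biclosed_def trans_def by blast
  have "(z, y) \<in> ?T \<or> (y, x) \<in> ?T" if "(z, x) \<in> ?T" "(z, y) \<in> G" "(y, x) \<in> G" for x y z
    using that
  proof (induction arbitrary: y rule: trancl_induct)
    case (base x)
    then show ?case using split by blast
  next
    case (step w x)
    have "(w, x) \<in> G" using step.hyps I J by (auto simp: biclosed_def)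
    \<comment> \<open>Totality compares \<open>y\<close> with the last intermediate point
      \<open>w\<close>. If \<open>y\<close> comes before \<open>w\<close>, the induction hypothesis
      splits the path up to \<open>w\<close>; if after, the edge \<open>(w, x)\<close> is
      split.\<close>
    then consider "y = w" | "(y, w) \<in> G" | "(w, y) \<in> G"
      using tot step.prems by (meson FieldI1 total_on_def)
    then show ?case
    proof cases
      case 1
      then show ?thesis using step.hyps by blast
    next
      case 2
      then show ?thesis using step.IH[of y] step.prems step.hyps by (meson trancl.trancl_into_trancl)
    next
      case 3
      then show ?thesis using split[of w x y] step.prems step.hyps
        by (meson r_into_trancl trancl.trancl_into_trancl)
    qed
  qed
  then have "trans (G - ?T)"
    using \<open>trans G\<close> unfolding trans_def by blast
  with sub show ?thesis by (simp add: biclosed_def)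
qed

text \<open>The total order whose set of inversions relative to \<open>G\<inverse>\<close> is \<open>K\<close>.\<close>

definition invert_on :: "('a \<times> 'a) set \<Rightarrow> ('a \<times> 'a) set \<Rightarrow> ('a \<times> 'a) set" where
  "invert_on G K = K \<union> (G - K)\<inverse>"

text \<open>If both pairs come from \<open>K\<close>, or both from the reversed complement, this is
  transitivity of \<open>K\<close> or of \<open>G - K\<close>. In the mixed cases \<open>x\<close>
  and \<open>z\<close> are comparable by totality, and a failure would contradict one of these two
  transitivities.\<close>

lemma trans_invert_on:
  assumes tot: "total_on (Field G) G" and K: "biclosed G K"
  shows "trans (invert_on G K)"
proof (rule transI)
  fix x y z assume xy: "(x, y) \<in> invert_on G K" and yz: "(y, z) \<in> invert_on G K"
  have cmp: "x = z \<or> (x, z) \<in> G \<or> (z, x) \<in> G"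
  proof -
    have "x \<in> Field G" "z \<in> Field G"
      using xy yz K by (auto simp: invert_on_def biclosed_def Field_def)
    with tot show ?thesis by (auto simp: total_on_def)
  qed
  have K2: "\<And>a b c. (a, b) \<in> K \<Longrightarrow> (b, c) \<in> K \<Longrightarrow> (a, c) \<in> K"
    and K3: "\<And>a b c. (a, b) \<in> G - K \<Longrightarrow> (b, c) \<in> G - K \<Longrightarrow> (a, c) \<in> G - K"
    using K unfolding biclosed_def trans_def by blast+
  show "(x, z) \<in> invert_on G K"
  proof (cases "(x, y) \<in> K")
    case True
    show ?thesis
    proof (cases "(y, z) \<in> K")
      case False
      then have "(z, y) \<in> G - K" using yz by (auto simp: invert_on_def)
      with True cmp K2[of z x y] K3[of x z y] show ?thesis
        unfolding invert_on_def by blast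
    qed (use True K2 in \<open>auto simp: invert_on_def\<close>)
  next
    case False
    then have yx: "(y, x) \<in> G - K" using xy by (auto simp: invert_on_def)
    show ?thesis
    proof (cases "(y, z) \<in> K")
      case True
      with yx cmp K2[of y z x] K3[of y x z] show ?thesis
        unfolding invert_on_def by blast
    next
      case False
      then have "(z, y) \<in> G - K" using yz by (auto simp: invert_on_def)
      with K3[OF this yx] show ?thesis by (simp add: invert_on_def)
    qed
  qed
qed

section \<open>Lists sorted by a relation\<close>

text \<open>Insertion sort: a new element is placed between its predecessors and its successors in
  the list already built.\<close>

lemma strict_linear_order_list:
  assumes "finite S" and "trans L" and "total_on S L" and "irrefl L"
  shows "\<exists>p. sorted_wrt (\<lambda>x y. (x, y) \<in> L) p \<and> distinct p \<and> set p = S"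
  using assms(1,3)
proof (induction S rule: finite_induct)
  case (insert x F)
  then obtain p where p: "sorted_wrt (\<lambda>x y. (x, y) \<in> L) p" "distinct p" "set p = F"
    by (auto simp: total_on_def)
  let ?A = "filter (\<lambda>y. (y, x) \<in> L) p" and ?B = "filter (\<lambda>y. (x, y) \<in> L) p"
  have "sorted_wrt (\<lambda>x y. (x, y) \<in> L) (?A @ x # ?B)"
    using p(1) assms(2) by (auto simp: sorted_wrt_append sorted_wrt_filter dest: transD)
  moreover have "distinct (?A @ x # ?B)"
    using p insert.hyps assms(2,4) by (auto simp: irrefl_def dest: transD)
  moreover have "set (?A @ x # ?B) = insert x F"
    using insert.prems insert.hyps p by (auto simp: total_on_def)
  ultimately show ?case by blast
qed simp

text \<open>Distinct heads would each occur in the tail of the other list, against the asymmetry of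
  \<open>P\<close>.\<close>

lemma sorted_wrt_unique:
  assumes "sorted_wrt P xs" "sorted_wrt P ys" "distinct xs" "distinct ys" "set xs = set ys"
    and "\<And>x y. P x y \<Longrightarrow> \<not> P y x"
  shows "xs = ys"
  using assms(1-5)
proof (induction xs arbitrary: ys)
  case (Cons x xs)
  then obtain y ys' where ys: "ys = y # ys'" by (cases ys) auto
  have "x = y"
  proof (rule ccontr)
    assume "x \<noteq> y"
    then have "x \<in> set ys'" "y \<in> set xs" using Cons.prems ys by (auto simp: set_eq_iff)
    then show False using Cons.prems ys assms(6) by auto
  qed
  moreover have "xs = ys'"
    using Cons.IH[of ys'] Cons.prems ys \<open>x = y\<close> by (auto simp: insert_eq_iff)
  ultimately show ?case using ys by simp
qed simp

lemma sorted_wrt_filter_iff: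
  "sorted_wrt P (filter Q p) \<longleftrightarrow> sorted_wrt (\<lambda>x y. Q x \<longrightarrow> Q y \<longrightarrow> P x y) p"
  by (induction p) auto

section \<open>Inversions of lists\<close>

abbreviation lex_less :: "((nat \<times> nat) \<times> (nat \<times> nat)) set" where
  "lex_less \<equiv> less_than <*lex*> less_than"

text \<open>The larger element comes first, as in \<open>inversions\<close>. For finite
  \<open>S\<close> this is the inversion set of the decreasing arrangement of \<open>S\<close>; it
  serves as the ground set \<open>G\<close> for biclosed sets.\<close>

definition descents_on :: "(nat \<times> nat) set \<Rightarrow> ((nat \<times> nat) \<times> (nat \<times> nat)) set" where
  "descents_on S = lex_less\<inverse> \<inter> S \<times> S"

lemma mem_descents_on:
  "(y, x) \<in> descents_on S \<longleftrightarrow> (x, y) \<in> lex_less \<and> x \<in> S \<and> y \<in> S"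
  by (auto simp: descents_on_def)

lemma trans_descents_on: "trans (descents_on S)"
  by (rule transI) (auto simp: mem_descents_on)

lemma irrefl_descents_on: "irrefl (descents_on S)"
  by (auto simp: irrefl_def mem_descents_on)

lemma total_on_descents_on: "total_on S (descents_on S)"
  by (auto simp: total_on_def mem_descents_on)

lemma total_on_Field_descents_on: "total_on (Field (descents_on S)) (descents_on S)"
  by (auto simp: total_on_def mem_descents_on Field_def)

lemma descents_on_asym: "(x, y) \<in> descents_on S \<Longrightarrow> (y, x) \<notin> descents_on S"
  by (meson irreflD irrefl_descents_on transD trans_descents_on)

lemma inversions_subset_iff:
  "inversions p \<subseteq> K \<longleftrightarrow> sorted_wrt (\<lambda>x y. (y, x) \<in> lex_less \<longrightarrow> (x, y) \<in> K) p"
  unfolding inversions_def sorted_wrt_iff_nth_less by blast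

lemma inversions_subset_descents_on: "inversions p \<subseteq> descents_on (set p)"
  unfolding inversions_def descents_on_def by auto

lemma inversion_nth_iff:
  assumes "distinct p" "a < length p" "b < length p"
  shows "(p ! a, p ! b) \<in> inversions p \<longleftrightarrow> a < b \<and> (p ! b, p ! a) \<in> lex_less"
  using assms unfolding inversions_def by (auto simp del: in_lex_prod simp: nth_eq_iff_index_eq)

text \<open>The relation depends on \<open>p\<close> only through its entries and its inversions, so
  these two determine the list.\<close>

lemma sorted_wrt_invert_on_inversions:
  assumes "distinct p"
  shows "sorted_wrt (\<lambda>x y. (x, y) \<in> invert_on (descents_on (set p)) (inversions p)) p"
  unfolding sorted_wrt_iff_nth_less
proof (intro allI impI)
  fix a b assume ab: "a < b" "b < length p"
  then have "p ! a \<noteq> p ! b" using assms by (simp add: nth_eq_iff_index_eq)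
  then have "(p ! a, p ! b) \<in> lex_less \<or> (p ! b, p ! a) \<in> lex_less"
    by (cases "p ! a"; cases "p ! b") auto
  with ab assms show "(p ! a, p ! b) \<in> invert_on (descents_on (set p)) (inversions p)"
    by (auto simp: invert_on_def mem_descents_on inversion_nth_iff simp del: in_lex_prod)
qed

text \<open>In terms of values and positions, an inversion is a descent in value with
  \<open>a < b\<close>, and a descending pair outside \<open>inversions p\<close> is one with
  \<open>b \<le> a\<close>. Each is an intersection of two transitive conditions.\<close>

lemma biclosed_inversions:
  assumes "distinct p"
  shows "biclosed (descents_on (set p)) (inversions p)"
proof -
  have nth: "x \<in> set p \<Longrightarrow> \<exists>a<length p. x = p ! a" for x by (auto simp: in_set_conv_nth)
  have "trans (inversions p)"
  proof (rule transI)
    fix x y z assume *: "(x, y) \<in> inversions p" "(y, z) \<in> inversions p"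
    then have "x \<in> set p" "y \<in> set p" "z \<in> set p"
      using inversions_subset_descents_on[of p] by (auto simp: descents_on_def)
    then obtain a b c where "a < length p" "b < length p" "c < length p"
      "x = p ! a" "y = p ! b" "z = p ! c" using nth by meson
    with * show "(x, z) \<in> inversions p"
      using trans_descents_on[of "set p", THEN transD, of x y z] assms
      by (auto simp: inversion_nth_iff mem_descents_on simp del: in_lex_prod)
  qed
  moreover have "trans (descents_on (set p) - inversions p)"
  proof (rule transI)
    fix x y z
    assume *: "(x, y) \<in> descents_on (set p) - inversions p"
      "(y, z) \<in> descents_on (set p) - inversions p"
    then have "x \<in> set p" "y \<in> set p" "z \<in> set p"
      by (auto simp: descents_on_def)
    then obtain a b c where "a < length p" "b < length p" "c < length p"
      "x = p ! a" "y = p ! b" "z = p ! c" using nth by meson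
    with * show "(x, z) \<in> descents_on (set p) - inversions p"
      using trans_descents_on[of "set p", THEN transD, of x y z] assms
      by (auto simp: inversion_nth_iff mem_descents_on simp del: in_lex_prod)
  qed
  ultimately show ?thesis
    using inversions_subset_descents_on by (simp add: biclosed_def)
qed

lemma inversions_sorted_wrt_invert_on:
  assumes K: "K \<subseteq> descents_on (set p)" and "distinct p"
    and p: "sorted_wrt (\<lambda>x y. (x, y) \<in> invert_on (descents_on (set p)) K) p"
  shows "inversions p = K"
proof
  show "inversions p \<subseteq> K"
    unfolding inversions_subset_iff
    by (rule sorted_wrt_mono_rel[OF _ p]) (auto simp: invert_on_def mem_descents_on)
  show "K \<subseteq> inversions p"
  proof
    fix q assume q: "q \<in> K"
    then obtain a b where ab: "q = (p ! a, p ! b)" "a < length p" "b < length p"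
      using K unfolding descents_on_def in_set_conv_nth[symmetric] set_conv_nth by blast
    have desc: "(p ! a, p ! b) \<in> descents_on (set p)" using K q ab by auto
    \<comment> \<open>In the opposite order the pair would be in \<open>K\<close>, against
      asymmetry, or its reverse would be in the complement of \<open>K\<close>, against
      \<open>q \<in> K\<close>.\<close>
    have "\<not> b < a"
    proof
      assume "b < a"
      then have "(p ! b, p ! a) \<in> invert_on (descents_on (set p)) K"
        using p ab by (simp add: sorted_wrt_iff_nth_less)
      then show False
        using K q ab descents_on_asym[OF desc] by (auto simp: invert_on_def)
    qed
    moreover have "a \<noteq> b" using desc irreflD[OF irrefl_descents_on] by blast
    ultimately show "q \<in> inversions p"
      using ab desc assms(2) by (simp add: inversion_nth_iff mem_descents_on del: in_lex_prod)
  qed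
qed

text \<open>The list is \<open>S\<close> sorted by \<open>invert_on (descents_on S) K\<close>, which
  is a strict total order on \<open>S\<close> because \<open>K\<close> is biclosed.\<close>

lemma ex_list_inversions:
  assumes "finite S" and K: "biclosed (descents_on S) K"
  shows "\<exists>p. distinct p \<and> set p = S \<and> inversions p = K"
proof -
  let ?L = "invert_on (descents_on S) K"
  have sub: "K \<subseteq> descents_on S" using K by (simp add: biclosed_def)
  have "trans ?L"
    by (rule trans_invert_on[OF total_on_Field_descents_on K])
  moreover have "total_on S ?L"
    using total_on_descents_on[of S] by (auto simp: total_on_def invert_on_def)
  moreover have "irrefl ?L"
    using irrefl_descents_on[of S] sub by (auto simp: irrefl_def invert_on_def)
  ultimately obtain p where "sorted_wrt (\<lambda>x y. (x, y) \<in> ?L) p" "distinct p" "set p = S"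
    using strict_linear_order_list[OF assms(1)] by blast
  with inversions_sorted_wrt_invert_on[of K p] sub show ?thesis by blast
qed

lemma inversions_inject:
  assumes "distinct p" "distinct q" "set p = set q" "inversions p = inversions q"
  shows "p = q"
proof (rule sorted_wrt_unique)
  let ?L = "invert_on (descents_on (set p)) (inversions p)"
  show "sorted_wrt (\<lambda>x y. (x, y) \<in> ?L) p" "sorted_wrt (\<lambda>x y. (x, y) \<in> ?L) q"
    using sorted_wrt_invert_on_inversions[of p] sorted_wrt_invert_on_inversions[of q] assms by simp_all
  show "(y, x) \<notin> ?L" if "(x, y) \<in> ?L" for x y
    using that inversions_subset_descents_on[of p] descents_on_asym[of _ _ "set p"]
    unfolding invert_on_def by blast
qed (use assms in auto)

section \<open>Standardization\<close>

text \<open>The set S of indexed letters, whose permutations are the standardized words.\<close>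

definition labels :: "nat list \<Rightarrow> (nat \<times> nat) set" where
  "labels ms = (SIGMA i:{1..length ms}. {1..ms ! (i - 1)})"

lemma finite_labels: "finite (labels ms)"
  by (simp add: labels_def)

lemma mem_newman_words_iff:
  "s \<in> newman_words ms \<longleftrightarrow>
    (\<forall>x. count_list s x = (if x \<in> {1..length ms} then ms ! (x - 1) else 0))"
  unfolding newman_words_def permutations_of_multiset_def
  by (simp add: multiset_eq_iff count_sum count_mset)

lemma standardize_Nil [simp]: "standardize [] = []"
  by (simp add: standardize_def)

text \<open>The index of an occurrence depends only on the prefix ending there, which is why the
  facts about \<open>standardize\<close> are proved by induction from the right.\<close>

lemma standardize_snoc [simp]:
  "standardize (s @ [x]) = standardize s @ [(x, Suc (count_list s x))]"
  by (auto simp: standardize_def nth_append)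

lemma length_standardize [simp]: "length (standardize s) = length s"
  by (simp add: standardize_def)

lemma map_fst_standardize [simp]: "map fst (standardize s) = s"
  by (induction s rule: rev_induct) auto

lemma mem_set_standardize:
  "(i, j) \<in> set (standardize s) \<longleftrightarrow> 1 \<le> j \<and> j \<le> count_list s i"
  by (induction s rule: rev_induct) auto

lemma distinct_standardize: "distinct (standardize s)"
  by (induction s rule: rev_induct) (auto simp: mem_set_standardize)

lemma set_standardize:
  assumes "s \<in> newman_words ms"
  shows "set (standardize s) = labels ms"
proof -
  have "count_list s i = (if i \<in> {1..length ms} then ms ! (i - 1) else 0)" for i
    using assms unfolding mem_newman_words_iff by blast
  then show ?thesis
    by (auto simp: mem_set_standardize labels_def split: if_splits)
qed

lemma sorted_wrt_standardize:
  "sorted_wrt (\<lambda>x y. fst x = fst y \<longrightarrow> snd x < snd y) (standardize s)"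
  by (induction s rule: rev_induct) (auto simp: sorted_wrt_append mem_set_standardize)

text \<open>Occurrences of one letter carry increasing indices from left to right, so they are never
  inverted, and the lexicographic comparison is decided by the letters.\<close>

lemma fst_inversion_standardize:
  assumes "(x, y) \<in> inversions (standardize s)"
  shows "fst y < fst x"
proof -
  have "inversions (standardize s) \<subseteq> {(x, y). fst x \<noteq> fst y}"
    unfolding inversions_subset_iff
    by (rule sorted_wrt_mono_rel[OF _ sorted_wrt_standardize]) auto
  with assms have "fst x \<noteq> fst y" by auto
  moreover have "(y, x) \<in> lex_less"
    using assms inversions_subset_descents_on unfolding descents_on_def by blast
  ultimately show ?thesis by (cases x; cases y) auto
qed

text \<open>This identifies the image of \<open>standardize\<close>: if the last pair is
  \<open>(i, j)\<close>, the earlier pairs with letter \<open>i\<close> have exactly the indices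
  below \<open>j\<close>, so counting them gives back \<open>j - 1\<close>.\<close>

lemma standardize_map_fst:
  assumes "distinct p" and "sorted_wrt (\<lambda>x y. fst x = fst y \<longrightarrow> snd x < snd y) p"
    and "\<And>i j j'. (i, j) \<in> set p \<Longrightarrow> 1 \<le> j' \<Longrightarrow> j' \<le> j \<Longrightarrow> (i, j') \<in> set p"
    and "\<And>i. (i, 0) \<notin> set p"
  shows "standardize (map fst p) = p"
  using assms
proof (induction p rule: rev_induct)
  case (snoc x p)
  obtain i j where x: "x = (i, j)" by force
  have less: "j' < j" if "(i, j') \<in> set p" for j'
    using snoc.prems(2) that x by (auto simp: sorted_wrt_append)
  have "standardize (map fst p) = p"
  proof (rule snoc.IH)
    \<comment> \<open>Removing the last pair preserves closure under smaller indices, since its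
      index exceeds all remaining ones of the same letter.\<close>
    show "(i', j'') \<in> set p" if "(i', j') \<in> set p" "1 \<le> j''" "j'' \<le> j'" for i' j' j''
      using snoc.prems(3)[of i' j' j''] that less[of j'] x by auto
  qed (use snoc.prems in \<open>auto simp: sorted_wrt_append\<close>)
  then have "(i, j') \<in> set p \<longleftrightarrow> 1 \<le> j' \<and> j' \<le> count_list (map fst p) i" for j'
    using mem_set_standardize[of i j' "map fst p"] by simp
  moreover have "(i, j') \<in> set p \<longleftrightarrow> 1 \<le> j' \<and> j' < j" for j'
    using snoc.prems(3)[of i j j'] snoc.prems(4)[of i] less[of j'] x
    by (cases j') auto
  ultimately have eq: "1 \<le> j' \<and> j' \<le> count_list (map fst p) i \<longleftrightarrow> 1 \<le> j' \<and> j' < j" for j'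
    by blast
  have "j > 0" using snoc.prems(4)[of i] x by (cases j) auto
  \<comment> \<open>The intervals from 1 to the count and from 1 to \<open>j - 1\<close> have the
    same elements; testing their end points shows that the bounds agree.\<close>
  then have "j = Suc (count_list (map fst p) i)"
    using eq[of "count_list (map fst p) i"] eq[of "j - 1"] eq[of "Suc (count_list (map fst p) i)"]
    by (cases "count_list (map fst p) i"; cases "j - 1") auto
  with \<open>standardize (map fst p) = p\<close> x show ?case by simp
qed simp

section \<open>The Newman lattice\<close>

text \<open>A list of the labels with inversion set \<open>K\<close> exists by biclosedness; since
  \<open>K\<close> inverts no equal letters, that list is the standardization of its word of
  letters.\<close>

lemma ex_newman_word:
  assumes K: "biclosed (descents_on (labels ms)) K" and fst: "\<And>x y. (x, y) \<in> K \<Longrightarrow> fst x \<noteq> fst y"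
  shows "\<exists>s\<in>newman_words ms. inversions (standardize s) = K"
proof -
  obtain p where p: "distinct p" "set p = labels ms" "inversions p = K"
    using ex_list_inversions[OF finite_labels K] by blast
  have "inversions p \<subseteq> {(x, y). fst x \<noteq> fst y}"
    using fst p(3) by auto
  \<comment> \<open>Distinctness is carried along so that, for equal letters, excluding an inversion
    yields a strict inequality of indices.\<close>
  then have "sorted_wrt (\<lambda>x y. x \<noteq> y \<and> ((y, x) \<in> lex_less \<longrightarrow> fst x \<noteq> fst y)) p"
    using p(1) unfolding inversions_subset_iff
    by (simp add: sorted_wrt_iff_nth_less nth_eq_iff_index_eq)
  then have "sorted_wrt (\<lambda>x y. fst x = fst y \<longrightarrow> snd x < snd y) p"
    by (rule sorted_wrt_mono_rel[rotated]) (auto simp: prod_eq_iff)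
  then have std: "standardize (map fst p) = p"
    by (rule standardize_map_fst[OF p(1)]) (auto simp: p(2) labels_def)
  \<comment> \<open>The indices of \<open>i\<close> in \<open>p\<close> form an initial interval,
    which \<open>labels ms\<close> prescribes; comparing cardinalities gives the
    multiplicity.\<close>
  have "count_list (map fst p) i = (if i \<in> {1..length ms} then ms ! (i - 1) else 0)" for i
  proof -
    have "1 \<le> j \<and> j \<le> count_list (map fst p) i \<longleftrightarrow>
        1 \<le> j \<and> j \<le> (if i \<in> {1..length ms} then ms ! (i - 1) else 0)" for j
      using mem_set_standardize[of i j "map fst p"] unfolding std p(2) by (auto simp: labels_def)
    then have "{1..count_list (map fst p) i} =
        {1..if i \<in> {1..length ms} then ms ! (i - 1) else 0}"
      unfolding set_eq_iff atLeastAtMost_iff by blast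
    from arg_cong[OF this, of card] show ?thesis by simp
  qed
  then have "map fst p \<in> newman_words ms" unfolding mem_newman_words_iff by blast
  with std p(3) show ?thesis by (intro bexI[of _ "map fst p"]) simp_all
qed

lemma biclosed_newman_word:
  assumes "s \<in> newman_words ms"
  shows "biclosed (descents_on (labels ms)) (inversions (standardize s))"
  using biclosed_inversions[OF distinct_standardize, of s] set_standardize[OF assms] by simp

lemma newman_le_antisym:
  assumes "s \<in> newman_words ms" "t \<in> newman_words ms" "newman_le s t" "newman_le t s"
  shows "s = t"
proof -
  have "standardize s = standardize t"
  proof (rule inversions_inject[OF distinct_standardize distinct_standardize])
    show "set (standardize s) = set (standardize t)" using assms by (simp add: set_standardize)
    show "inversions (standardize s) = inversions (standardize t)"
      using assms unfolding newman_le_def by (intro equalityI)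
  qed
  then show ?thesis by (metis map_fst_standardize)
qed

text \<open>The inversion set of any common upper bound is transitive and contains both sets, hence
  their transitive closure, and that closure is itself the inversion set of a word.\<close>

lemma newman_join:
  assumes s: "s \<in> newman_words ms" and t: "t \<in> newman_words ms"
  shows "\<exists>j\<in>newman_words ms. newman_le s j \<and> newman_le t j \<and>
    (\<forall>u\<in>newman_words ms. newman_le s u \<longrightarrow> newman_le t u \<longrightarrow> newman_le j u)"
proof -
  let ?U = "inversions (standardize s) \<union> inversions (standardize t)"
  have "biclosed (descents_on (labels ms)) (?U\<^sup>+)"
    by (intro biclosed_trancl_Un trans_descents_on total_on_Field_descents_on biclosed_newman_word s t)
  \<comment> \<open>Letters strictly decrease along every inversion, hence along chains, so the
    closure contains no pair of equal letters.\<close>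
  moreover have "fst y < fst x" if "(x, y) \<in> ?U\<^sup>+" for x y
    using that by (induction rule: trancl_induct) (auto dest: fst_inversion_standardize)
  ultimately obtain j where j: "j \<in> newman_words ms" "inversions (standardize j) = ?U\<^sup>+"
    using ex_newman_word[of ms "?U\<^sup>+"] by (metis less_irrefl)
  have "?U\<^sup>+ \<subseteq> inversions (standardize u)"
    if "u \<in> newman_words ms" "newman_le s u" "newman_le t u" for u
  proof -
    have "trans (inversions (standardize u))"
      using biclosed_newman_word[OF that(1)] by (simp add: biclosed_def)
    moreover have "?U \<subseteq> inversions (standardize u)" using that by (simp add: newman_le_def)
    ultimately show ?thesis by (metis trancl_id trancl_mono_subset)
  qed
  moreover have "?U \<subseteq> ?U\<^sup>+" by auto
  ultimately show ?thesis using j by (intro bexI[of _ j]) (auto simp: newman_le_def)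
qed

text \<open>Dual to the join: \<open>?U\<close> collects the descending pairs left uninverted by
  \<open>s\<close> or by \<open>t\<close>, and the meet inverts exactly the descending pairs outside
  its closure.\<close>

lemma newman_meet:
  assumes s: "s \<in> newman_words ms" and t: "t \<in> newman_words ms"
  shows "\<exists>m\<in>newman_words ms. newman_le m s \<and> newman_le m t \<and>
    (\<forall>u\<in>newman_words ms. newman_le u s \<longrightarrow> newman_le u t \<longrightarrow> newman_le u m)"
proof -
  let ?G = "descents_on (labels ms)"
  let ?U = "(?G - inversions (standardize s)) \<union> (?G - inversions (standardize t))"
  have bi: "biclosed ?G (?G - ?U\<^sup>+)"
    by (intro biclosed_Diff biclosed_trancl_Un trans_descents_on total_on_Field_descents_on
        biclosed_newman_word s t)
  have sub: "?G - ?U\<^sup>+ \<subseteq> inversions (standardize s)" "?G - ?U\<^sup>+ \<subseteq> inversions (standardize t)"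
    by auto
  \<comment> \<open>Every pair outside the closure is an inversion of \<open>s\<close>, and
    inversions of a word have distinct letters.\<close>
  have "fst x \<noteq> fst y" if "(x, y) \<in> ?G - ?U\<^sup>+" for x y
    using fst_inversion_standardize[OF subsetD[OF sub(1) that]] by simp
  then obtain m where m: "m \<in> newman_words ms" "inversions (standardize m) = ?G - ?U\<^sup>+"
    using ex_newman_word[OF bi] by blast
  have "inversions (standardize u) \<subseteq> ?G - ?U\<^sup>+"
    if "u \<in> newman_words ms" "newman_le u s" "newman_le u t" for u
  proof -
    have u: "trans (?G - inversions (standardize u))" "inversions (standardize u) \<subseteq> ?G"
      using biclosed_newman_word[OF that(1)] by (simp_all add: biclosed_def)
    have "?U \<subseteq> ?G - inversions (standardize u)" using that by (auto simp: newman_le_def)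
    with u have "?U\<^sup>+ \<subseteq> ?G - inversions (standardize u)" by (metis trancl_id trancl_mono_subset)
    with u show ?thesis by blast
  qed
  with m sub show ?thesis by (intro bexI[of _ m]) (auto simp: newman_le_def)
qed

lemma newman_poset_simps [simp]:
  "carrier (newman_poset ms) = newman_words ms" "le (newman_poset ms) = newman_le"
  "eq (newman_poset ms) = (=)"
  by (simp_all add: newman_poset_def)

lemma newman_le_refl: "newman_le s s"
  by (simp add: newman_le_def)

lemma newman_le_trans: "newman_le s t \<Longrightarrow> newman_le t u \<Longrightarrow> newman_le s u"
  unfolding newman_le_def by (rule subset_trans)

lemma lattice_newman_poset: "lattice (newman_poset ms)"
  by (rule latticeI)
    (simp_all add: newman_le_refl newman_join newman_meet newman_le_antisym[of _ ms],
      blast intro: newman_le_trans)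

section \<open>Words with increasing first occurrences\<close>

lemma first_occurrences_conv_standardize:
  "first_occurrences s = map fst (filter (\<lambda>x. snd x = 1) (standardize s))"
proof (induction s rule: rev_induct)
  case (snoc x s)
  have "x \<in> set s \<longleftrightarrow> count_list s x \<noteq> 0" by (simp add: count_list_0_iff)
  with snoc show ?case by (simp add: first_occurrences_def)
qed (simp add: first_occurrences_def)

lemma first_occurrences_map_inj:
  "inj f \<Longrightarrow> first_occurrences (map f s) = map f (first_occurrences s)"
  by (simp add: first_occurrences_def rev_map remdups_map_inj)

text \<open>
  The inversions of the word \<open>1 2 \<dots> n\<close> followed by the remaining letters in decreasing order.
\<close>

definition late_inversions :: "nat list \<Rightarrow> ((nat \<times> nat) \<times> (nat \<times> nat)) set" where
  "late_inversions ms = {(x, y) \<in> descents_on (labels ms). fst x \<noteq> fst y \<and> snd y \<noteq> 1}"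

lemma biclosed_late_inversions: "biclosed (descents_on (labels ms)) (late_inversions ms)"
proof -
  have "trans (late_inversions ms)"
    by (rule transI) (auto simp: late_inversions_def mem_descents_on)
  \<comment> \<open>For consecutive pairs \<open>(x, y)\<close> and \<open>(y, z)\<close>, either
    \<open>z\<close> has index 1, or \<open>y\<close> and \<open>z\<close> share a letter. Then
    \<open>y\<close> has index above 1, as indices start at 1, so \<open>x\<close> shares that
    letter too.\<close>
  moreover have "trans (descents_on (labels ms) - late_inversions ms)"
    by (rule transI) (auto simp: late_inversions_def mem_descents_on labels_def)
  ultimately show ?thesis by (auto simp: biclosed_def late_inversions_def)
qed

text \<open>If the word inverts no pair ending in a first occurrence, the first occurrences are in
  increasing order. Conversely, a larger letter before the first \<open>i\<close> would have its own
  first occurrence before it as well.\<close>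

lemma inversions_subset_late_iff:
  assumes s: "s \<in> newman_words ms"
  shows "inversions (standardize s) \<subseteq> late_inversions ms \<longleftrightarrow>
    sorted_wrt (<) (first_occurrences s)"
proof -
  let ?p = "standardize s"
  have sorted_iff: "sorted_wrt (<) (first_occurrences s) \<longleftrightarrow>
      sorted_wrt (\<lambda>x y. snd x = 1 \<longrightarrow> snd y = 1 \<longrightarrow> fst x < fst y) ?p"
    by (simp add: first_occurrences_conv_standardize sorted_wrt_map sorted_wrt_filter_iff)
  show ?thesis
  proof
    assume "inversions ?p \<subseteq> late_inversions ms"
    then have inv: "(?p ! b, ?p ! a) \<in> lex_less \<Longrightarrow> snd (?p ! b) \<noteq> 1"
      if "a < b" "b < length ?p" for a b
      using that inversion_nth_iff[OF distinct_standardize, of a s b]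
      unfolding late_inversions_def by auto
    show "sorted_wrt (<) (first_occurrences s)"
      unfolding sorted_iff unfolding sorted_wrt_iff_nth_less
    proof (intro allI impI)
      fix a b assume ab: "a < b" "b < length ?p" "snd (?p ! a) = 1" "snd (?p ! b) = 1"
      then have "?p ! a \<noteq> ?p ! b" using distinct_standardize[of s] by (simp add: nth_eq_iff_index_eq)
      moreover have "(?p ! b, ?p ! a) \<notin> lex_less" using inv[OF ab(1,2)] ab(4) by blast
      ultimately show "fst (?p ! a) < fst (?p ! b)"
        using ab(3,4) by (cases "?p ! a"; cases "?p ! b") auto
    qed
  next
    assume sorted: "sorted_wrt (<) (first_occurrences s)"
    show "inversions ?p \<subseteq> late_inversions ms"
    proof
      fix q assume q: "q \<in> inversions ?p"
      then obtain a b where ab: "q = (?p ! a, ?p ! b)" "a < b" "b < length ?p"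
        unfolding inversions_def by blast
      have less: "fst (?p ! b) < fst (?p ! a)"
        using fst_inversion_standardize q ab(1) by blast
      have "snd (?p ! b) \<noteq> 1"
      proof
        assume b1: "snd (?p ! b) = 1"
        obtain j l where jl: "?p ! a = (j, l)" by force
        have "(j, l) \<in> set ?p" using jl ab by (metis nth_mem less_trans)
        then have l: "1 \<le> l" and "(j, 1) \<in> set ?p" by (auto simp: mem_set_standardize)
        then obtain c where c: "c < length ?p" "?p ! c = (j, 1)" by (metis in_set_conv_nth)
        \<comment> \<open>Position \<open>c\<close> holds the first occurrence of \<open>j\<close>,
          and position \<open>a\<close> some occurrence of \<open>j\<close>, so \<open>c\<close>
          cannot come later.\<close>
        have "\<not> a < c"
          using sorted_wrt_nth_less[OF sorted_wrt_standardize, of a c s] c jl l by auto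
        then have "c < b" using ab by simp
        then have "j < fst (?p ! b)"
          using sorted_wrt_nth_less[OF sorted[unfolded sorted_iff], of c b] c ab b1 by auto
        with less jl show False by simp
      qed
      moreover have "q \<in> descents_on (labels ms)"
        using q inversions_subset_descents_on[of ?p] set_standardize[OF s] by auto
      ultimately show "q \<in> late_inversions ms" using ab(1) less by (simp add: late_inversions_def)
    qed
  qed
qed

lemma sorted_first_occurrences_iff:
  assumes "set s = {1..n}"
  shows "sorted_wrt (<) (first_occurrences s) \<longleftrightarrow> first_occurrences s = [1..<Suc n]"
proof
  assume sorted: "sorted_wrt (<) (first_occurrences s)"
  have "distinct (first_occurrences s)" "set (first_occurrences s) = set [1..<Suc n]"
    unfolding first_occurrences_def set_upt atLeastLessThanSuc_atLeastAtMost
    by (simp_all add: assms)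
  then show "first_occurrences s = [1..<Suc n]"
    by (intro sorted_wrt_unique[OF sorted sorted_wrt_upt _ distinct_upt]) (simp_all only: less_not_sym not_False_eq_True)
qed (simp only: sorted_wrt_upt)

section \<open>Canonical representatives\<close>

text \<open>The canonical representative computed from a single word of the orbit.\<close>

definition canonical_word :: "nat \<Rightarrow> nat list \<Rightarrow> nat list" where
  "canonical_word n s = map (Hilbert_Choice.inv (first_occ_perm n s)) s"

lemma first_occurrences_conv_perm:
  assumes "set s = {1..n}"
  shows "first_occurrences s = map (first_occ_perm n s) [1..<Suc n]"
  by (rule nth_equalityI)
    (use assms in \<open>auto simp: length_first_occurrences first_occ_perm_def simp del: upt_Suc\<close>)

text \<open>Taking first occurrences commutes with injective relabeling, so the inverse of \<tau> is
  applied to the one-line notation of \<tau> itself.\<close>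

lemma first_occurrences_canonical_word:
  assumes "set s = {1..n}"
  shows "first_occurrences (canonical_word n s) = [1..<Suc n]"
proof -
  let ?t = "first_occ_perm n s"
  have t: "?t permutes {1..n}" by (rule first_occ_perm_permutes[OF assms])
  then have "inj (Hilbert_Choice.inv ?t)" by (intro permutes_inj permutes_inv)
  then have "first_occurrences (canonical_word n s) = map (Hilbert_Choice.inv ?t) (map ?t [1..<Suc n])"
    unfolding canonical_word_def
    by (simp only: first_occurrences_map_inj first_occurrences_conv_perm[OF assms, symmetric])
  then show ?thesis using permutes_inv_o(2)[OF t] by (simp del: upt_Suc)
qed

lemma canonical_word_id:
  assumes "first_occurrences s = [1..<Suc n]"
  shows "canonical_word n s = s"
proof -
  have "first_occ_perm n s = id"
    using assms by (auto simp: first_occ_perm_def fun_eq_iff simp del: upt_Suc)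
  then show ?thesis by (simp add: canonical_word_def)
qed

section \<open>The relabeling action on words and its orbits\<close>

lemma orbit_sym_group:
  "orbit (sym_group n) map s = (\<lambda>p. map p s) ` {p. p permutes {1..n}}"
  by (auto simp: orbit_def sym_group_def)

lemma orbit_map_eq:
  assumes p: "p permutes {1..n}"
  shows "orbit (sym_group n) map (map p s) = orbit (sym_group n) map s"
proof -
  have "map q s = map (q \<circ> Hilbert_Choice.inv p) (map p s)" for q :: "nat \<Rightarrow> nat"
    using permutes_inv_o(2)[OF p] by (simp add: comp_assoc)
  then show ?thesis
    using permutes_compose[OF p] permutes_compose[OF permutes_inv[OF p]]
    unfolding orbit_sym_group by (fastforce simp: image_iff)
qed

text \<open>Relabeling permutes the multiplicities, and these are all equal to
  \<open>m\<close>.\<close>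

lemma map_permutes_newman_words:
  assumes s: "s \<in> newman_words (replicate n m)" and p: "p permutes {1..n}"
  shows "map p s \<in> newman_words (replicate n m)"
  unfolding mem_newman_words_iff
proof
  fix x
  have "count_list (map p s) x = count_list s (Hilbert_Choice.inv p x)"
    by (induction s) (auto simp: permutes_inv_eq[OF p] permutes_inverses[OF p])
  also have "\<dots> = (if x \<in> {1..n} then m else 0)"
    using s permutes_in_image[OF permutes_inv[OF p], of x]
    unfolding mem_newman_words_iff by (auto simp: nth_replicate)
  finally show "count_list (map p s) x =
      (if x \<in> {1..length (replicate n m)} then replicate n m ! (x - 1) else 0)"
    by auto
qed

section \<open>The isomorphism with a principal ideal, and the lattice property\<close>

theorem theorem2:
  fixes n k :: nat
  assumes "n \<ge> 1"
  shows "(\<exists>\<alpha>\<in>carrier (newman_poset (barcode_mults n k)).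
            order_isomorphic (barcode_poset n k)
              (principal_down_set (newman_poset (barcode_mults n k)) \<alpha>))
         \<and> lattice (barcode_poset n k)"
proof -
  let ?ms = "barcode_mults n k"
  let ?W = "newman_words ?ms"
  let ?O = "orbit (sym_group n) map"
  have len: "length ?ms = n" by (simp add: barcode_mults_def)
  have pos: "\<forall>i\<in>{1..length ?ms}. ?ms ! (i - 1) > 0" by (auto simp: barcode_mults_def)
  have set: "set s = {1..n}" if "s \<in> ?W" for s
    using set_newman_words[OF that pos] len by simp
  have perm: "map p s \<in> ?W" if "s \<in> ?W" "p permutes {1..n}" for p s
    using map_permutes_newman_words[of s n "2 ^ k + 1" p] that by (simp add: barcode_mults_def)
  have rep: "canonical_rep n (?O s) = canonical_word n s" if "s \<in> ?W" for s
    using canonical_rep_orbit[OF that pos] by (simp add: len canonical_word_def)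
  have "fst x \<noteq> fst y" if "(x, y) \<in> late_inversions ?ms" for x y
    using that by (simp add: late_inversions_def)
  then obtain \<alpha> where \<alpha>: "\<alpha> \<in> ?W" "inversions (standardize \<alpha>) = late_inversions ?ms"
    using ex_newman_word[OF biclosed_late_inversions] by blast
  \<comment> \<open>The ideal of \<alpha> consists of the words whose first occurrences read 1, ...,
    n, that is, those with trivial \<tau>.\<close>
  have le_\<alpha>: "newman_le s \<alpha> \<longleftrightarrow> first_occurrences s = [1..<Suc n]" if "s \<in> ?W" for s
    unfolding newman_le_def \<alpha>(2) inversions_subset_late_iff[OF that]
    by (rule sorted_first_occurrences_iff[OF set[OF that]])
  have canonical: "canonical_word n s \<in> {t \<in> ?W. newman_le t \<alpha>}" if "s \<in> ?W" for s
  proof -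
    have "canonical_word n s \<in> ?W"
      unfolding canonical_word_def
      by (intro perm that permutes_inv first_occ_perm_permutes set)
    then show ?thesis using le_\<alpha> first_occurrences_canonical_word[OF set[OF that]] by simp
  qed
  have orbit: "?O (canonical_word n s) = ?O s" if "s \<in> ?W" for s
    unfolding canonical_word_def
    by (intro orbit_map_eq that permutes_inv first_occ_perm_permutes set)
  have "bij_betw (canonical_rep n) (?O ` ?W) {s \<in> ?W. newman_le s \<alpha>}"
  \<comment> \<open>The inverse map sends a word to its orbit: a canonical word lies in the orbit it
    represents, and a word below \<alpha> is its own canonical word.\<close>
  proof (rule bij_betw_byWitness[where f' = ?O])
    show "\<forall>X\<in>?O ` ?W. ?O (canonical_rep n X) = X"
      using rep orbit by simp
    show "\<forall>s\<in>{s \<in> ?W. newman_le s \<alpha>}. canonical_rep n (?O s) = s"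
      using rep le_\<alpha> canonical_word_id by (metis (lifting) mem_Collect_eq)
    show "canonical_rep n ` ?O ` ?W \<subseteq> {s \<in> ?W. newman_le s \<alpha>}"
      using rep canonical by auto
  qed auto
  moreover have "carrier (barcode_poset n k) = ?O ` ?W"
    by (auto simp: barcode_poset_def orbits_def)
  \<comment> \<open>Compatibility with the orders is immediate, as the barcode order is by
    definition the Newman order of the canonical representatives.\<close>
  ultimately have iso: "order_isomorphic (barcode_poset n k)
      (principal_down_set (newman_poset ?ms) \<alpha>)"
    unfolding order_isomorphic_def
    by (intro exI[of _ "canonical_rep n"]) (simp add: barcode_poset_def principal_down_set_def)
  moreover have "lattice (barcode_poset n k)"
    by (rule lattice_order_isomorphic[OF iso])
      (simp_all add: lattice_principal_down_set lattice_newman_poset \<alpha>(1) barcode_poset_def)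
  ultimately show ?thesis using \<alpha>(1) by auto
qed

end
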